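(* Let $n\geq 4$ and let $L_n$ be the line graph of an $n$-dimensional hypercube-like network. Then $L_n$ is $(4n-10)$-conditional edge-fault-tolerant strongly Menger edge connected. Further, if $k>4n-10$, then $L_n$ is not $k$-conditional edge-fault-tolerant strongly Menger edge connected.
   Context: For two disjoint graphs $G_1,G_2$ with the same number of vertices and a bijection $f:V(G_1)\to V(G_2)$, $G_1\oplus_f G_2$ denotes the graph obtained from $G_1\cup G_2$ by adding the edges $(v,f(v))$ for all $v\in V(G_1)$. The $n$-dimensional hypercube-like networks are defined recursively: $K_2$ is the only $1$-dimensional hypercube-like network; for $n\geq 2$, if $Q^1_{n-1}$ and $Q^2_{n-1}$ are (disjoint) $(n-1)$-dimensional hypercube-like networks, then $Q^1_{n-1}\oplus_f Q^2_{n-1}$ is an $n$-dimensional hypercube-like network for every bijection $f:V(Q^1_{n-1})\to V(Q^2_{n-1})$. The line graph $L(G)$ of a graph $G$ has vertex set $E(G)$, two vertices being adjacent iff the corresponding edges share an end-vertex. A connected graph $G$ is strongly Menger edge connected if for any two distinct vertices $u,v$ of $G$ there are $\min\{\deg_G(u),\deg_G(v)\}$ edge-disjoint $(u,v)$-paths in $G$. For a positive integer $m$, a connected graph $G$ is $m$-conditional edge-fault-tolerant strongly Menger edge connected if $G-F$ is strongly Menger edge connected for every edge set $F\subseteq E(G)$ with $|F|\leq m$ and minimum degree $\delta(G-F)\geq 2$ (degrees being taken in $G-F$). *)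

theory Defs
  imports Main
begin

text \<open>Undirected simple graphs: an edge is the two-element set of its end-vertices.\<close>

record 'a graph =
  verts :: "'a set"
  edges :: "'a set set"

definition degree :: "'a graph \<Rightarrow> 'a \<Rightarrow> nat" where
  "degree G v = card {e \<in> edges G. v \<in> e}"

text \<open>Meaningful for graphs with a finite nonempty vertex set only.\<close>

definition min_degree :: "'a graph \<Rightarrow> nat" where
  "min_degree G = Min (degree G ` verts G)"

definition delete_edges :: "'a graph \<Rightarrow> 'a set set \<Rightarrow> 'a graph" where
  "delete_edges G F = \<lparr>verts = verts G, edges = edges G - F\<rparr>"

definition path_edges :: "'a list \<Rightarrow> 'a set set" where
  "path_edges p = {{p ! i, p ! Suc i} | i. Suc i < length p}"

definition is_path :: "'a graph \<Rightarrow> 'a \<Rightarrow> 'a \<Rightarrow> 'a list \<Rightarrow> bool" where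
  "is_path G u v p \<longleftrightarrow>
     p \<noteq> [] \<and> hd p = u \<and> last p = v \<and> distinct p \<and>
     set p \<subseteq> verts G \<and> path_edges p \<subseteq> edges G"

definition connected_graph :: "'a graph \<Rightarrow> bool" where
  "connected_graph G \<longleftrightarrow>
     verts G \<noteq> {} \<and> (\<forall>u \<in> verts G. \<forall>v \<in> verts G. \<exists>p. is_path G u v p)"

definition strongly_Menger_edge_connected :: "'a graph \<Rightarrow> bool" where
  "strongly_Menger_edge_connected G \<longleftrightarrow>
     connected_graph G \<and>
     (\<forall>u \<in> verts G. \<forall>v \<in> verts G. u \<noteq> v \<longrightarrow>
        (\<exists>P. finite P \<and> card P = min (degree G u) (degree G v) \<and>
             (\<forall>p \<in> P. is_path G u v p) \<and>
             pairwise (\<lambda>p q. disjnt (path_edges p) (path_edges q)) P))"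

definition conditional_eft_strongly_Menger :: "nat \<Rightarrow> 'a graph \<Rightarrow> bool" where
  "conditional_eft_strongly_Menger m G \<longleftrightarrow>
     connected_graph G \<and>
     (\<forall>F. F \<subseteq> edges G \<longrightarrow> finite F \<longrightarrow> card F \<le> m \<longrightarrow>
        min_degree (delete_edges G F) \<ge> 2 \<longrightarrow>
        strongly_Menger_edge_connected (delete_edges G F))"

definition line_graph :: "'a graph \<Rightarrow> 'a set graph" where
  "line_graph G =
     \<lparr>verts = edges G,
      edges = {{e, e'} | e e'. e \<in> edges G \<and> e' \<in> edges G \<and> e \<noteq> e' \<and> e \<inter> e' \<noteq> {}}\<rparr>"

definition matching_join :: "('a \<Rightarrow> 'a) \<Rightarrow> 'a graph \<Rightarrow> 'a graph \<Rightarrow> 'a graph" where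
  "matching_join f G\<^sub>1 G\<^sub>2 =
     \<lparr>verts = verts G\<^sub>1 \<union> verts G\<^sub>2,
      edges = edges G\<^sub>1 \<union> edges G\<^sub>2 \<union> {{v, f v} | v. v \<in> verts G\<^sub>1}\<rparr>"

text \<open>The base case admits every copy of \<open>K\<^sub>2\<close>, so the predicate is
  invariant under renaming vertices within the type \<open>'a\<close>.\<close>

inductive hypercube_like :: "nat \<Rightarrow> 'a graph \<Rightarrow> bool" where
  K2: "u \<noteq> v \<Longrightarrow> hypercube_like 1 \<lparr>verts = {u, v}, edges = {{u, v}}\<rparr>"
| join: "\<lbrakk>hypercube_like n G\<^sub>1; hypercube_like n G\<^sub>2; verts G\<^sub>1 \<inter> verts G\<^sub>2 = {};
         bij_betw f (verts G\<^sub>1) (verts G\<^sub>2)\<rbrakk>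
    \<Longrightarrow> hypercube_like (Suc n) (matching_join f G\<^sub>1 G\<^sub>2)"

end

theory Submission
  imports Defs
begin

text \<open>
  By the edge version of Menger's theorem it suffices to bound, for a set \<open>S\<close> of vertices of
  \<open>L\<^sub>n\<close> separating \<open>u\<close> from \<open>v\<close>, the number of non-faulty edges leaving \<open>S\<close> from below. If \<open>S\<close> or its
  complement has at most two elements, minimum degree \<open>2\<close> is enough. Otherwise \<open>S\<close> is a set of
  edges of the network, and \<open>\<Sum> s\<^sub>x (n - s\<^sub>x)\<close> edges of \<open>L\<^sub>n\<close> leave it, where \<open>s\<^sub>x\<close> counts the edges
  of \<open>S\<close> at the vertex \<open>x\<close>. This sum is at least \<open>6n - 12 = (4n - 10) + (2n - 2)\<close>: it is large if
  many vertices are mixed (\<open>0 < s\<^sub>x < n\<close>), and if there are few, then \<open>n\<close>-connectedness forces \<open>S\<close>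
  or its complement to live on at most five vertices, where triangle-freeness gives the bound.
  The minimum \<open>6n - 12\<close> is attained by three edges at a common vertex, which yields sharpness.
\<close>

section \<open>Simple graphs\<close>

locale simple_graph =
  fixes G :: "'a graph"
  assumes finite_verts: "finite (verts G)"
    and edge_subset: "e \<in> edges G \<Longrightarrow> e \<subseteq> verts G"
    and card_edge: "e \<in> edges G \<Longrightarrow> card e = 2"

definition incident :: "'a set set \<Rightarrow> 'a \<Rightarrow> 'a set set" where
  "incident S x = {e \<in> S. x \<in> e}"

definition neighbours :: "'a graph \<Rightarrow> 'a \<Rightarrow> 'a set" where
  "neighbours G x = {y. {x, y} \<in> edges G}"

definition edge_cut :: "'a graph \<Rightarrow> 'a set \<Rightarrow> 'a set set" where
  "edge_cut G S = {e \<in> edges G. e \<inter> S \<noteq> {} \<and> \<not> e \<subseteq> S}"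

definition regular_graph :: "nat \<Rightarrow> 'a graph \<Rightarrow> bool" where
  "regular_graph d G \<longleftrightarrow> (\<forall>x \<in> verts G. degree G x = d)"

definition clique :: "'a graph \<Rightarrow> 'a set \<Rightarrow> bool" where
  "clique G S \<longleftrightarrow> S \<subseteq> verts G \<and> (\<forall>x \<in> S. \<forall>y \<in> S. x \<noteq> y \<longrightarrow> {x, y} \<in> edges G)"

lemma verts_delete_edges [simp]: "verts (delete_edges G F) = verts G"
  and edges_delete_edges [simp]: "edges (delete_edges G F) = edges G - F"
  by (simp_all add: delete_edges_def)

lemma delete_edges_empty [simp]: "delete_edges G {} = G"
  by (simp add: delete_edges_def)

lemma edge_cut_delete_edges: "edge_cut (delete_edges G F) S = edge_cut G S - F"
  by (auto simp: edge_cut_def)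

lemma simple_graph_delete_edges: "simple_graph G \<Longrightarrow> simple_graph (delete_edges G F)"
  by (simp add: simple_graph_def)

context simple_graph
begin

lemma finite_edges: "finite (edges G)"
  by (rule finite_subset[of _ "Pow (verts G)"]) (use edge_subset finite_verts in auto)

lemma finite_edge: "e \<in> edges G \<Longrightarrow> finite e"
  using edge_subset finite_verts finite_subset by metis

lemma edgeD:
  assumes "{x, y} \<in> edges G"
  shows "x \<noteq> y" "x \<in> verts G" "y \<in> verts G"
  using assms edge_subset[OF assms] card_edge[OF assms] by auto

lemma edgeE:
  assumes "e \<in> edges G"
  obtains x y where "x \<noteq> y" "e = {x, y}" "x \<in> verts G" "y \<in> verts G"
  using card_edge[OF assms] edge_subset[OF assms] by (auto simp: card_2_iff)

lemma edge_eq_doubleton: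
  assumes "e \<in> edges G" "x \<in> e" "y \<in> e" "x \<noteq> y"
  shows "e = {x, y}"
  using assms(1) by (rule edgeE) (use assms(2-4) in auto)

lemma edge_other_end:
  assumes "e \<in> edges G" "x \<in> e"
  obtains y where "e = {x, y}"
proof (rule edgeE[OF assms(1)])
  fix a b assume "e = {a, b}"
  then show thesis using that[of a] that[of b] assms(2) by (auto simp: insert_commute)
qed

lemma neighbours_subset: "neighbours G x \<subseteq> verts G - {x}"
  by (auto simp: neighbours_def dest: edgeD)

lemma finite_neighbours: "finite (neighbours G x)"
  using finite_subset[OF neighbours_subset] finite_verts by blast

lemma card_incident:
  assumes "S \<subseteq> edges G"
  shows "card (incident S x) = card {y. {x, y} \<in> S}"
proof -
  have "incident S x = (\<lambda>y. {x, y}) ` {y. {x, y} \<in> S}"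
  proof (intro equalityI subsetI)
    fix e assume e: "e \<in> incident S x"
    then obtain y where "e = {x, y}"
      using assms edge_other_end[of e x] by (auto simp: incident_def)
    then show "e \<in> (\<lambda>y. {x, y}) ` {y. {x, y} \<in> S}" using e by (auto simp: incident_def)
  qed (auto simp: incident_def)
  moreover have "inj_on (\<lambda>y. {x, y}) {y. {x, y} \<in> S}" by (auto simp: inj_on_def doubleton_eq_iff)
  ultimately show ?thesis by (simp add: card_image)
qed

lemma degree_eq_card_neighbours: "degree G x = card (neighbours G x)"
  using card_incident[OF order_refl] by (simp add: degree_def incident_def neighbours_def)

lemma finite_edge_cut: "finite (edge_cut G S)"
  using finite_edges by (simp add: edge_cut_def)

lemma edge_cut_eq_empty_iff:
  "edge_cut G S = {} \<longleftrightarrow> (\<forall>x y. {x, y} \<in> edges G \<longrightarrow> (x \<in> S \<longleftrightarrow> y \<in> S))"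
proof -
  have "e \<subseteq> S \<or> e \<inter> S = {}"
    if "e \<in> edges G" "\<forall>x y. {x, y} \<in> edges G \<longrightarrow> (x \<in> S \<longleftrightarrow> y \<in> S)" for e
    using that(1) by (rule edgeE) (use that in auto)
  then show ?thesis by (fastforce simp: edge_cut_def)
qed

lemma edge_cut_complement: "S \<subseteq> verts G \<Longrightarrow> edge_cut G (verts G - S) = edge_cut G S"
  using edge_subset unfolding edge_cut_def by blast

lemma card_edge_cut:
  assumes "finite S"
  shows "card (edge_cut G S) = (\<Sum>x\<in>S. card (neighbours G x - S))"
proof -
  let ?A = "SIGMA x:S. neighbours G x - S"
  have "edge_cut G S = (\<lambda>(x, y). {x, y}) ` ?A"
  proof (intro equalityI subsetI)
    fix e assume "e \<in> edge_cut G S"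
    then obtain x y where "e \<in> edges G" "x \<in> e" "x \<in> S" "y \<in> e" "y \<notin> S"
      by (auto simp: edge_cut_def)
    moreover from this have "e = {x, y}" by (intro edge_eq_doubleton) auto
    ultimately show "e \<in> (\<lambda>(x, y). {x, y}) ` ?A"
      by (intro image_eqI[of _ _ "(x, y)"]) (auto simp: neighbours_def)
  qed (auto simp: edge_cut_def neighbours_def)
  moreover have "inj_on (\<lambda>(x, y). {x, y}) ?A" by (auto simp: inj_on_def doubleton_eq_iff)
  ultimately have "card (edge_cut G S) = card ?A" by (simp add: card_image)
  also have "\<dots> = (\<Sum>x\<in>S. card (neighbours G x - S))"
    using assms finite_neighbours by (intro card_SigmaI) auto
  finally show ?thesis .
qed

lemma degree_eq_card_edge_cut: "degree G x = card (edge_cut G {x})"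
proof -
  have "neighbours G x - {x} = neighbours G x" using neighbours_subset by blast
  then show ?thesis by (simp add: card_edge_cut degree_eq_card_neighbours)
qed

lemma degree_le_card_neighbours_outside:
  assumes "finite S" "x \<in> S"
  shows "degree G x \<le> card (neighbours G x - S) + (card S - 1)"
proof -
  have "neighbours G x \<subseteq> (neighbours G x - S) \<union> (S - {x})"
    using neighbours_subset by blast
  then have "card (neighbours G x) \<le> card ((neighbours G x - S) \<union> (S - {x}))"
    using assms finite_neighbours by (intro card_mono) auto
  also have "\<dots> \<le> card (neighbours G x - S) + card (S - {x})" by (rule card_Un_le)
  finally show ?thesis using assms by (simp add: degree_eq_card_neighbours)
qed

text \<open>Each of the \<open>|S| - 1\<close> vertices of \<open>S\<close> other than \<open>u\<close> sends an edge out of \<open>S\<close>, which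
  makes up for the at most \<open>|S| - 1\<close> edges from \<open>u\<close> that stay in \<open>S\<close>.\<close>

lemma degree_le_card_edge_cut:
  assumes S: "finite S" "u \<in> S" and deg: "\<And>x. x \<in> S \<Longrightarrow> card S \<le> degree G x"
  shows "degree G u \<le> card (edge_cut G S)"
proof -
  have "1 \<le> card (neighbours G x - S)" if "x \<in> S" for x
    using degree_le_card_neighbours_outside[OF S(1) that] deg[OF that] S
    by (cases "card S") auto
  then have "card (S - {u}) \<le> (\<Sum>x\<in>S - {u}. card (neighbours G x - S))"
    using sum_bounded_below[of "S - {u}" 1 "\<lambda>x. card (neighbours G x - S)"] by simp
  then have "degree G u \<le> card (neighbours G u - S) + (\<Sum>x\<in>S - {u}. card (neighbours G x - S))"
    using degree_le_card_neighbours_outside[OF S] S by simp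
  also have "\<dots> = card (edge_cut G S)"
    using S by (simp add: card_edge_cut sum.remove)
  finally show ?thesis .
qed

lemma card_neighbours_outside_clique:
  assumes "clique G S" "finite S" "x \<in> S"
  shows "card (neighbours G x - S) = degree G x - (card S - 1)"
proof -
  have "neighbours G x \<inter> S = S - {x}"
    using assms(1,3) neighbours_subset by (fastforce simp: clique_def neighbours_def)
  then show ?thesis
    using assms by (simp add: card_Diff_subset_Int degree_eq_card_neighbours)
qed

lemma le_min_degree_iff:
  assumes "verts G \<noteq> {}"
  shows "k \<le> min_degree G \<longleftrightarrow> (\<forall>x \<in> verts G. k \<le> degree G x)"
  using assms finite_verts by (simp add: min_degree_def)

end

section \<open>Paths and connectedness\<close>

lemma path_edges_Nil [simp]: "path_edges [] = {}"
  and path_edges_single [simp]: "path_edges [a] = {}"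
  by (auto simp: path_edges_def)

lemma path_edges_Cons_Cons [simp]:
  "path_edges (a # b # p) = insert {a, b} (path_edges (b # p))"
proof -
  have "{i. Suc i < length (a # b # p)} = insert 0 (Suc ` {i. Suc i < length (b # p)})"
    by (auto simp: image_iff gr0_conv_Suc less_Suc_eq_0_disj)
  moreover have "path_edges q = (\<lambda>i. {q ! i, q ! Suc i}) ` {i. Suc i < length q}" for q :: "'a list"
    by (auto simp: path_edges_def)
  ultimately show ?thesis by (simp add: image_image)
qed

lemma path_edge_subset: "e \<in> path_edges p \<Longrightarrow> e \<subseteq> set p"
  by (auto simp: path_edges_def)

lemma path_edges_subset_iff_successively:
  "path_edges p \<subseteq> E \<longleftrightarrow> successively (\<lambda>x y. {x, y} \<in> E) p"
  by (induction p rule: induct_list012) auto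

lemma path_edges_eq_empty_iff: "path_edges p = {} \<longleftrightarrow> length p \<le> 1"
  by (cases p rule: remdups_adj.cases) auto

lemma path_edges_meet_edge_cut:
  assumes "p \<noteq> []" "hd p \<in> S" "last p \<notin> S" "path_edges p \<subseteq> edges G"
  shows "path_edges p \<inter> edge_cut G S \<noteq> {}"
  using assms
proof (induction p rule: induct_list012)
  case (3 a b p)
  then show ?case by (cases "b \<in> S") (auto simp: edge_cut_def)
qed auto

lemma rtranclp_imp_distinct_path:
  assumes "R\<^sup>*\<^sup>* u v"
  obtains p where "p \<noteq> []" "hd p = u" "last p = v" "distinct p" "successively R p"
proof -
  have "\<exists>p. p \<noteq> [] \<and> hd p = u \<and> last p = v \<and> distinct p \<and> successively R p"
    using assms
  proof (induction rule: converse_rtranclp_induct)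
    case base
    show ?case by (rule exI[of _ "[v]"]) simp
  next
    case (step x y)
    then obtain p where p: "p \<noteq> []" "hd p = y" "last p = v" "distinct p" "successively R p"
      by blast
    show ?case
    proof (cases "x \<in> set p")
      case True
      then obtain a b where "p = a @ x # b" by (meson split_list)
      then show ?thesis
        using p by (intro exI[of _ "x # b"]) (auto simp: successively_append_iff)
    next
      case False
      then show ?thesis
        using p step.hyps by (intro exI[of _ "x # p"]) (auto simp: successively_Cons)
    qed
  qed
  then show thesis using that by blast
qed

lemma distinct_path_or_closed_set:
  assumes "u \<in> V" "v \<in> V"
  obtains (path) p where "p \<noteq> []" "hd p = u" "last p = v" "distinct p" "successively R p"
  | (closed) X where "X \<subseteq> V" "u \<in> X" "v \<notin> X" "\<And>x y. x \<in> X \<Longrightarrow> y \<in> V - X \<Longrightarrow> \<not> R x y"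
proof (cases "R\<^sup>*\<^sup>* u v")
  case True
  then show thesis using path by (rule rtranclp_imp_distinct_path)
next
  case False
  then show thesis
    using assms closed[of "{x \<in> V. R\<^sup>*\<^sup>* u x}"]
    by (auto dest: rtranclp.rtrancl_into_rtrancl)
qed

context simple_graph
begin

lemma successively_imp_is_path:
  assumes p: "p \<noteq> []" "hd p \<in> verts G" "distinct p" "successively (\<lambda>x y. {x, y} \<in> edges G) p"
  shows "is_path G (hd p) (last p) p"
proof -
  have "set p \<subseteq> verts G"
    using p(1,2,4)
  proof (induction p rule: induct_list012)
    case (3 a b p)
    then show ?case using edgeD(3)[of a b] by simp
  qed simp_all
  then show ?thesis
    using p by (simp add: is_path_def path_edges_subset_iff_successively)
qed

lemma connected_graph_iff_edge_cut:
  "connected_graph G \<longleftrightarrow>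
     verts G \<noteq> {} \<and> (\<forall>S \<subseteq> verts G. edge_cut G S = {} \<longrightarrow> S = {} \<or> S = verts G)"
  (is "_ \<longleftrightarrow> _ \<and> ?cuts")
proof (intro iffI conjI allI impI)
  fix S assume G: "connected_graph G" and S: "S \<subseteq> verts G" "edge_cut G S = {}"
  have "v \<in> S" if uv: "u \<in> S" "v \<in> verts G" for u v
  proof -
    obtain p where "is_path G u v p" using G S(1) uv unfolding connected_graph_def by blast
    then show ?thesis
      using path_edges_meet_edge_cut[of p S G] S(2) uv(1) by (auto simp: is_path_def)
  qed
  then show "S = {} \<or> S = verts G" using S(1) by blast
next
  assume cuts: "verts G \<noteq> {} \<and> ?cuts"
  have "\<exists>p. is_path G u v p" if uv: "u \<in> verts G" "v \<in> verts G" for u v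
    using uv
  proof (cases rule: distinct_path_or_closed_set[where R = "\<lambda>x y. {x, y} \<in> edges G"])
    case (path p)
    then show ?thesis using successively_imp_is_path[of p] uv by metis
  next
    case (closed X)
    have "edge_cut G X = {}"
      unfolding edge_cut_eq_empty_iff
    proof (intro allI impI)
      fix x y assume "{x, y} \<in> edges G"
      then show "x \<in> X \<longleftrightarrow> y \<in> X"
        using closed(4)[of x y] closed(4)[of y x] edgeD[of x y] by (auto simp: insert_commute)
    qed
    then show ?thesis using cuts closed(1-3) uv by blast
  qed
  then show "connected_graph G" using cuts by (simp add: connected_graph_def)
qed (simp add: connected_graph_def)

end

section \<open>Unit flows and Menger's theorem\<close>

definition edge_disjoint_paths :: "'a graph \<Rightarrow> 'a \<Rightarrow> 'a \<Rightarrow> 'a list set \<Rightarrow> bool" where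
  "edge_disjoint_paths G u v P \<longleftrightarrow>
     (\<forall>p \<in> P. is_path G u v p) \<and> pairwise (\<lambda>p q. disjnt (path_edges p) (path_edges q)) P"

definition unit_flow :: "'a graph \<Rightarrow> 'a \<Rightarrow> 'a \<Rightarrow> nat \<Rightarrow> ('a \<Rightarrow> 'a \<Rightarrow> int) \<Rightarrow> bool" where
  "unit_flow G u v k f \<longleftrightarrow>
     (\<forall>x y. f x y = - f y x) \<and>
     (\<forall>x y. f x y \<le> of_bool ({x, y} \<in> edges G)) \<and>
     (\<forall>x \<in> verts G. (\<Sum>y\<in>verts G. f x y) = int k * (of_bool (x = u) - of_bool (x = v)))"

fun path_flow :: "'a list \<Rightarrow> 'a \<Rightarrow> 'a \<Rightarrow> int" where
  "path_flow (a # b # p) x y =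
     of_bool (x = a \<and> y = b) - of_bool (x = b \<and> y = a) + path_flow (b # p) x y"
| "path_flow _ x y = 0"

lemma path_flow_antisym: "path_flow p x y = - path_flow p y x"
proof -
  have "path_flow p x y + path_flow p y x = 0"
    by (induction p rule: induct_list012) (auto simp: conj_commute)
  then show ?thesis by linarith
qed

lemma path_flow_outside: "x \<notin> set p \<or> y \<notin> set p \<Longrightarrow> path_flow p x y = 0"
proof (induction p rule: induct_list012)
  case (3 a b p)
  then have "path_flow (b # p) x y = 0" "x = a \<Longrightarrow> y \<noteq> b" "x = b \<Longrightarrow> y \<noteq> a" by auto
  then show ?case unfolding path_flow.simps by auto
qed simp_all

lemma sum_path_flow:
  assumes "finite V" "set p \<subseteq> V" "p \<noteq> []"
  shows "(\<Sum>y\<in>V. path_flow p x y) = of_bool (x = hd p) - of_bool (x = last p)"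
  using assms
proof (induction p rule: induct_list012)
  case (3 a b p)
  have "(\<Sum>y\<in>V. of_bool (x = a \<and> y = b) :: int) = of_bool (x = a)"
    "(\<Sum>y\<in>V. of_bool (x = b \<and> y = a) :: int) = of_bool (x = b)"
    using 3(3,4) by (cases "x = a"; cases "x = b"; simp)+
  moreover have "(\<Sum>y\<in>V. path_flow (b # p) x y) = of_bool (x = b) - of_bool (x = last (b # p))"
    using 3 by simp
  ultimately show ?case by (simp add: sum.distrib sum_subtractf)
qed simp_all

lemma path_flow_pos:
  assumes "distinct p" "successively R p" "path_flow p x y > 0"
  shows "path_flow p x y = 1 \<and> R x y"
  using assms
proof (induction p rule: induct_list012)
  case (3 a b p)
  show ?case
  proof (cases "x = a \<or> y = a")
    case True
    then have "path_flow (b # p) x y = 0" using 3 by (intro path_flow_outside) auto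
    then show ?thesis using 3 by (auto split: if_splits simp: of_bool_def)
  next
    case False
    then show ?thesis using 3 by auto
  qed
qed auto

lemma path_flow_eq_0_iff:
  assumes "distinct p"
  shows "path_flow p x y = 0 \<longleftrightarrow> {x, y} \<notin> path_edges p"
  using assms
proof (induction p rule: induct_list012)
  case (3 a b p)
  show ?case
  proof (cases "x = a \<or> y = a")
    case True
    then have "path_flow (b # p) x y = 0" using 3 by (intro path_flow_outside) auto
    moreover have "{x, y} \<notin> path_edges (b # p)"
      using True 3(3) path_edge_subset[of "{x, y}" "b # p"] by auto
    ultimately show ?thesis using 3 by (auto simp: doubleton_eq_iff)
  next
    case False
    then show ?thesis using 3 by (auto simp: doubleton_eq_iff)
  qed
qed auto

lemma unit_flowD:
  assumes "unit_flow G u v k f"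
  shows "f x y = - f y x"
    and "f x y \<le> of_bool ({x, y} \<in> edges G)"
    and "x \<in> verts G \<Longrightarrow> (\<Sum>y\<in>verts G. f x y) = int k * (of_bool (x = u) - of_bool (x = v))"
  using assms unfolding unit_flow_def by blast+

context simple_graph
begin

lemma unit_flow_across_cut:
  assumes f: "unit_flow G u v k f" and X: "X \<subseteq> verts G" "u \<in> X" "v \<notin> X"
  shows "(\<Sum>x\<in>X. \<Sum>y\<in>verts G - X. f x y) = int k"
proof -
  have "(\<Sum>x\<in>X. \<Sum>y\<in>X. f x y) = (\<Sum>x\<in>X. \<Sum>y\<in>X. - f y x)"
    by (intro sum.cong refl unit_flowD(1)[OF f])
  also have "\<dots> = - (\<Sum>x\<in>X. \<Sum>y\<in>X. f y x)" by (simp add: sum_negf)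
  also have "(\<Sum>x\<in>X. \<Sum>y\<in>X. f y x) = (\<Sum>x\<in>X. \<Sum>y\<in>X. f x y)" by (rule sum.swap)
  finally have inner: "(\<Sum>x\<in>X. \<Sum>y\<in>X. f x y) = 0" by simp
  have "(\<Sum>x\<in>X. \<Sum>y\<in>verts G. f x y) = (\<Sum>x\<in>X. (\<Sum>y\<in>verts G - X. f x y) + (\<Sum>y\<in>X. f x y))"
    by (intro sum.cong refl sum.subset_diff[OF X(1) finite_verts])
  also have "\<dots> = (\<Sum>x\<in>X. \<Sum>y\<in>verts G - X. f x y)"
    by (simp add: sum.distrib inner)
  also have "(\<Sum>x\<in>X. \<Sum>y\<in>verts G. f x y) = (\<Sum>x\<in>X. int k * (of_bool (x = u) - of_bool (x = v)))"
    using X by (intro sum.cong refl unit_flowD(3)[OF f]) auto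
  also have "\<dots> = (\<Sum>x\<in>X. if x = u then int k else 0)"
    using X by (intro sum.cong) auto
  also have "\<dots> = int k" using X finite_subset[OF X(1) finite_verts] by simp
  finally show ?thesis by simp
qed

lemma unit_flow_saturates_edge_cut:
  assumes f: "unit_flow G u v k f" and X: "X \<subseteq> verts G" "u \<in> X" "v \<notin> X"
    and sat: "\<And>x y. x \<in> X \<Longrightarrow> y \<in> verts G - X \<Longrightarrow> f x y = of_bool ({x, y} \<in> edges G)"
  shows "card (edge_cut G X) = k"
proof -
  have "int (card (edge_cut G X)) = (\<Sum>x\<in>X. int (card (neighbours G x - X)))"
    using finite_subset[OF X(1) finite_verts] by (simp add: card_edge_cut)
  also have "\<dots> = (\<Sum>x\<in>X. \<Sum>y\<in>verts G - X. f x y)"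
  proof (intro sum.cong refl)
    fix x assume x: "x \<in> X"
    have "neighbours G x - X = (verts G - X) \<inter> {y. {x, y} \<in> edges G}"
      using neighbours_subset by (auto simp: neighbours_def)
    then show "int (card (neighbours G x - X)) = (\<Sum>y\<in>verts G - X. f x y)"
      using x finite_verts by (simp add: sat sum_of_bool_eq)
  qed
  also have "\<dots> = int k" by (rule unit_flow_across_cut[OF f X])
  finally show ?thesis by simp
qed

lemma unit_flow_add_path:
  assumes f: "unit_flow G u v k f"
    and p: "is_path G u v p" "successively (\<lambda>x y. f x y < of_bool ({x, y} \<in> edges G)) p"
  shows "unit_flow G u v (Suc k) (\<lambda>x y. f x y + path_flow p x y)"
  unfolding unit_flow_def
proof (intro conjI allI ballI)
  have path: "p \<noteq> []" "hd p = u" "last p = v" "distinct p" "set p \<subseteq> verts G"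
    using p(1) by (simp_all add: is_path_def)
  fix x y
  show "f x y + path_flow p x y = - (f y x + path_flow p y x)"
    using unit_flowD(1)[OF f, of x y] path_flow_antisym[of p x y] by simp
  show "f x y + path_flow p x y \<le> of_bool ({x, y} \<in> edges G)"
  proof (cases "path_flow p x y > 0")
    case True
    then show ?thesis using path_flow_pos[OF path(4) p(2), of x y] by simp
  next
    case False
    then show ?thesis using unit_flowD(2)[OF f, of x y] by simp
  qed
  show "(\<Sum>y\<in>verts G. f x y + path_flow p x y) = int (Suc k) * (of_bool (x = u) - of_bool (x = v))"
    if "x \<in> verts G"
    using unit_flowD(3)[OF f that] sum_path_flow[OF finite_verts path(5,1), of x] path(2,3)
    by (simp add: sum.distrib algebra_simps)
qed

lemma unit_flow_remove_path:
  assumes f: "unit_flow G u v (Suc k) f"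
    and p: "is_path G u v p" "successively (\<lambda>x y. 0 < f x y) p"
  shows "unit_flow (delete_edges G (path_edges p)) u v k (\<lambda>x y. f x y - path_flow p x y)"
  unfolding unit_flow_def verts_delete_edges edges_delete_edges
proof (intro conjI allI ballI)
  have path: "p \<noteq> []" "hd p = u" "last p = v" "distinct p" "set p \<subseteq> verts G"
    using p(1) by (simp_all add: is_path_def)
  fix x y
  note anti = unit_flowD(1)[OF f, of x y] path_flow_antisym[of p x y]
  have cap: "f a b \<le> 1" for a b using unit_flowD(2)[OF f, of a b] by (rule order_trans) simp
  show "f x y - path_flow p x y = - (f y x - path_flow p y x)" using anti by simp
  consider "path_flow p x y > 0" | "path_flow p y x > 0" | "path_flow p x y = 0"
    using anti(2) by linarith
  then show "f x y - path_flow p x y \<le> of_bool ({x, y} \<in> edges G - path_edges p)"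
  proof cases
    case 1
    then have "path_flow p x y = 1 \<and> 0 < f x y" by (rule path_flow_pos[OF path(4) p(2)])
    then show ?thesis using cap[of x y] by simp
  next
    case 2
    then have "path_flow p y x = 1 \<and> 0 < f y x" by (rule path_flow_pos[OF path(4) p(2)])
    then show ?thesis using anti by simp
  next
    case 3
    then show ?thesis
      using path_flow_eq_0_iff[OF path(4), of x y] unit_flowD(2)[OF f, of x y] by simp
  qed
  show "(\<Sum>y\<in>verts G. f x y - path_flow p x y) = int k * (of_bool (x = u) - of_bool (x = v))"
    if "x \<in> verts G"
    using unit_flowD(3)[OF f that] sum_path_flow[OF finite_verts path(5,1), of x] path(2,3)
    by (simp add: sum_subtractf algebra_simps)
qed

lemma unit_flow_augment:
  assumes uv: "u \<in> verts G" "v \<in> verts G" and f: "unit_flow G u v k f"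
    and cut: "\<And>S. S \<subseteq> verts G \<Longrightarrow> u \<in> S \<Longrightarrow> v \<notin> S \<Longrightarrow> k < card (edge_cut G S)"
  shows "\<exists>f'. unit_flow G u v (Suc k) f'"
  using uv
proof (cases rule: distinct_path_or_closed_set
    [where R = "\<lambda>x y. f x y < of_bool ({x, y} \<in> edges G)"])
  case (path p)
  have "{x, y} \<in> edges G" if "f x y < of_bool ({x, y} \<in> edges G)" for x y
    using that unit_flowD(1)[OF f, of x y] unit_flowD(2)[OF f, of y x]
    by (cases "{x, y} \<in> edges G") (simp_all add: insert_commute)
  then have "successively (\<lambda>x y. {x, y} \<in> edges G) p"
    using path(5) by (rule successively_mono[rotated])
  then have "is_path G u v p" using successively_imp_is_path[of p] path uv by simp
  then show ?thesis using unit_flow_add_path[OF f _ path(5)] by blast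
next
  case (closed X)
  have "f x y = of_bool ({x, y} \<in> edges G)" if "x \<in> X" "y \<in> verts G - X" for x y
    using closed(4)[OF that] unit_flowD(2)[OF f, of x y] by simp
  then have "card (edge_cut G X) = k"
    by (rule unit_flow_saturates_edge_cut[OF f closed(1-3)])
  then show ?thesis using cut[OF closed(1-3)] by simp
qed

lemma unit_flow_positive_path:
  assumes uv: "u \<in> verts G" "v \<in> verts G" and f: "unit_flow G u v (Suc k) f"
  obtains p where "is_path G u v p" "successively (\<lambda>x y. 0 < f x y) p"
  using uv
proof (cases rule: distinct_path_or_closed_set[where R = "\<lambda>x y. 0 < f x y"])
  case (path p)
  have "{x, y} \<in> edges G" if "0 < f x y" for x y
    using that unit_flowD(2)[OF f, of x y] by (cases "{x, y} \<in> edges G") auto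
  then have "successively (\<lambda>x y. {x, y} \<in> edges G) p"
    using path(5) by (rule successively_mono[rotated])
  then have "is_path G u v p" using successively_imp_is_path[of p] path uv by simp
  then show thesis using path(5) by (rule that)
next
  case (closed X)
  then have "(\<Sum>x\<in>X. \<Sum>y\<in>verts G - X. f x y) \<le> 0" by (intro sum_nonpos) (auto simp: not_less)
  then show thesis using unit_flow_across_cut[OF f closed(1-3)] by simp
qed

lemma edge_disjoint_paths_le_edge_cut:
  assumes P: "edge_disjoint_paths G u v P" and S: "u \<in> S" "v \<notin> S"
  shows "card P \<le> card (edge_cut G S)"
proof -
  have "\<exists>e. e \<in> path_edges p \<inter> edge_cut G S" if "p \<in> P" for p
    using P that S path_edges_meet_edge_cut[of p S G]
    by (auto simp: edge_disjoint_paths_def is_path_def)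
  then obtain g where g: "\<And>p. p \<in> P \<Longrightarrow> g p \<in> path_edges p \<inter> edge_cut G S" by metis
  have "disjnt (path_edges p) (path_edges q)" if "p \<in> P" "q \<in> P" "p \<noteq> q" for p q
    using P that by (auto simp: edge_disjoint_paths_def dest: pairwiseD)
  then have "inj_on g P" using g by (intro inj_onI) (metis IntE disjnt_iff)
  then show ?thesis using g finite_edge_cut by (intro card_inj_on_le[of g]) auto
qed

end

lemma edge_disjoint_paths_insert:
  assumes p: "is_path G u v p" "u \<noteq> v"
    and P: "edge_disjoint_paths (delete_edges G (path_edges p)) u v P"
  shows "edge_disjoint_paths G u v (insert p P)" and "p \<notin> P"
proof -
  have q: "is_path G u v q" "disjnt (path_edges q) (path_edges p)" if "q \<in> P" for q
    using P that by (auto simp: edge_disjoint_paths_def is_path_def disjnt_def)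
  then show "edge_disjoint_paths G u v (insert p P)"
    using P p(1) by (auto simp: edge_disjoint_paths_def pairwise_insert disjnt_sym)
  have "path_edges p \<noteq> {}"
    using p by (cases p) (auto simp: is_path_def path_edges_eq_empty_iff)
  then show "p \<notin> P" using q(2)[of p] by (auto simp: disjnt_def)
qed

lemma unit_flow_imp_edge_disjoint_paths:
  assumes "simple_graph G" "u \<in> verts G" "v \<in> verts G" "u \<noteq> v" "unit_flow G u v k f"
  shows "\<exists>P. finite P \<and> card P = k \<and> edge_disjoint_paths G u v P"
  using assms
proof (induction k arbitrary: G f)
  case 0
  show ?case by (rule exI[of _ "{}"]) (simp add: edge_disjoint_paths_def)
next
  case (Suc k)
  then interpret simple_graph G by simp
  obtain p where p: "is_path G u v p" "successively (\<lambda>x y. 0 < f x y) p"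
    by (rule unit_flow_positive_path[OF Suc.prems(2,3,5)])
  let ?G' = "delete_edges G (path_edges p)"
  have "unit_flow ?G' u v k (\<lambda>x y. f x y - path_flow p x y)"
    by (rule unit_flow_remove_path[OF Suc.prems(5) p])
  then obtain P where P: "finite P" "card P = k" "edge_disjoint_paths ?G' u v P"
    using Suc.IH[of ?G'] Suc.prems simple_graph_delete_edges by auto
  then show ?case
    using edge_disjoint_paths_insert[OF p(1) Suc.prems(4) P(3)]
    by (intro exI[of _ "insert p P"]) simp
qed

context simple_graph
begin

theorem Menger_edge:
  assumes uv: "u \<in> verts G" "v \<in> verts G" "u \<noteq> v"
  shows "(\<exists>P. finite P \<and> card P = k \<and> edge_disjoint_paths G u v P) \<longleftrightarrow>
    (\<forall>S \<subseteq> verts G. u \<in> S \<longrightarrow> v \<notin> S \<longrightarrow> k \<le> card (edge_cut G S))"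
    (is "?paths \<longleftrightarrow> ?cuts")
proof
  assume ?paths
  then obtain P where "card P = k" "edge_disjoint_paths G u v P" by blast
  then show ?cuts using edge_disjoint_paths_le_edge_cut by metis
next
  assume cuts: ?cuts
  have "\<exists>f. unit_flow G u v j f" if "j \<le> k" for j
    using that
  proof (induction j)
    case 0
    have "unit_flow G u v 0 (\<lambda>_ _. 0)" by (simp add: unit_flow_def)
    then show ?case by blast
  next
    case (Suc j)
    then obtain f where "unit_flow G u v j f" by auto
    moreover have "j < card (edge_cut G S)" if "S \<subseteq> verts G" "u \<in> S" "v \<notin> S" for S
      using cuts that Suc.prems by (meson Suc_le_lessD order_trans)
    ultimately show ?case by (rule unit_flow_augment[OF uv(1,2)])
  qed
  then obtain f where "unit_flow G u v k f" by blast
  then show ?paths by (rule unit_flow_imp_edge_disjoint_paths[OF simple_graph_axioms uv])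
qed

lemma strongly_Menger_edge_connected_iff_edge_cut:
  "strongly_Menger_edge_connected G \<longleftrightarrow> connected_graph G \<and>
     (\<forall>u \<in> verts G. \<forall>v \<in> verts G. u \<noteq> v \<longrightarrow>
        (\<forall>S \<subseteq> verts G. u \<in> S \<longrightarrow> v \<notin> S \<longrightarrow>
           min (degree G u) (degree G v) \<le> card (edge_cut G S)))"
  unfolding strongly_Menger_edge_connected_def
  by (simp add: Menger_edge[unfolded edge_disjoint_paths_def] cong: ball_cong)

lemma strongly_Menger_edge_connectedD:
  assumes "strongly_Menger_edge_connected G" "S \<subseteq> verts G" "u \<in> S" "v \<in> verts G - S"
  shows "min (degree G u) (degree G v) \<le> card (edge_cut G S)"
  using assms(1)[unfolded strongly_Menger_edge_connected_iff_edge_cut, THEN conjunct2,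
      rule_format, of u v S] assms(2-4) by auto

lemma strongly_Menger_edge_connectedI:
  assumes "verts G \<noteq> {}" and deg: "\<And>x. x \<in> verts G \<Longrightarrow> 0 < degree G x"
    and cut: "\<And>S u v. S \<subseteq> verts G \<Longrightarrow> u \<in> S \<Longrightarrow> v \<in> verts G - S \<Longrightarrow>
      min (degree G u) (degree G v) \<le> card (edge_cut G S)"
  shows "strongly_Menger_edge_connected G"
proof -
  have "S = {} \<or> S = verts G" if S: "S \<subseteq> verts G" "edge_cut G S = {}" for S
  proof (rule ccontr)
    assume "\<not> (S = {} \<or> S = verts G)"
    then obtain u v where "u \<in> S" "v \<in> verts G - S" using S(1) by blast
    then show False using cut[of S u v] deg[of u] deg[of v] S by auto
  qed
  then have "connected_graph G" using assms(1) by (simp add: connected_graph_iff_edge_cut)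
  then show ?thesis using cut by (simp add: strongly_Menger_edge_connected_iff_edge_cut)
qed

lemma strongly_Menger_edge_connected_if_large_cuts:
  assumes "verts G \<noteq> {}" "0 < k" and deg: "\<And>x. x \<in> verts G \<Longrightarrow> k \<le> degree G x"
    and large: "\<And>S x. S \<subseteq> verts G \<Longrightarrow> k < card S \<Longrightarrow> k < card (verts G - S) \<Longrightarrow> x \<in> verts G \<Longrightarrow>
      degree G x \<le> card (edge_cut G S)"
  shows "strongly_Menger_edge_connected G"
proof (rule strongly_Menger_edge_connectedI[OF assms(1)])
  show "0 < degree G x" if "x \<in> verts G" for x using deg[OF that] \<open>0 < k\<close> by simp
  have small: "degree G x \<le> card (edge_cut G S)" if "S \<subseteq> verts G" "x \<in> S" "card S \<le> k" for S x
  proof (rule degree_le_card_edge_cut)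
    show "finite S" using that(1) finite_verts by (rule finite_subset)
    show "card S \<le> degree G y" if "y \<in> S" for y
      using deg[of y] that \<open>S \<subseteq> verts G\<close> \<open>card S \<le> k\<close> by fastforce
  qed (rule that)
  fix S u v assume S: "S \<subseteq> verts G" "u \<in> S" "v \<in> verts G - S"
  consider "card S \<le> k" | "card (verts G - S) \<le> k" | "k < card S" "k < card (verts G - S)"
    by linarith
  then show "min (degree G u) (degree G v) \<le> card (edge_cut G S)"
  proof cases
    case 1
    then show ?thesis using small[OF S(1,2)] by simp
  next
    case 2
    then show ?thesis using small[of "verts G - S" v] S edge_cut_complement[OF S(1)] by simp
  next
    case 3
    then show ?thesis using large[of S u] S by auto
  qed
qed

end

section \<open>Vertex connectivity and matching joins\<close>

definition delete_verts :: "'a graph \<Rightarrow> 'a set \<Rightarrow> 'a graph" where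
  "delete_verts G M = \<lparr>verts = verts G - M, edges = {e \<in> edges G. e \<inter> M = {}}\<rparr>"

definition vertex_connected :: "nat \<Rightarrow> 'a graph \<Rightarrow> bool" where
  "vertex_connected k G \<longleftrightarrow> k < card (verts G) \<and>
     (\<forall>M \<subseteq> verts G. card M < k \<longrightarrow> connected_graph (delete_verts G M))"

definition triangle_free :: "'a graph \<Rightarrow> bool" where
  "triangle_free G \<longleftrightarrow>
     (\<forall>x y. {x, y} \<in> edges G \<longrightarrow> neighbours G x \<inter> neighbours G y = {})"

definition edge_closed_outside :: "'a graph \<Rightarrow> 'a set \<Rightarrow> 'a set \<Rightarrow> bool" where
  "edge_closed_outside G M S \<longleftrightarrow>
     (\<forall>x y. {x, y} \<in> edges G \<longrightarrow> x \<notin> M \<longrightarrow> y \<notin> M \<longrightarrow> (x \<in> S \<longleftrightarrow> y \<in> S))"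

context simple_graph
begin

lemma simple_graph_delete_verts: "simple_graph (delete_verts G M)"
  using finite_verts edge_subset card_edge
  by unfold_locales (auto simp: delete_verts_def)

lemma edge_cut_delete_verts_eq_empty_iff:
  "edge_cut (delete_verts G M) S = {} \<longleftrightarrow> edge_closed_outside G M S"
  unfolding simple_graph.edge_cut_eq_empty_iff[OF simple_graph_delete_verts]
  by (auto simp: delete_verts_def edge_closed_outside_def)

lemma connected_delete_verts_iff:
  "connected_graph (delete_verts G M) \<longleftrightarrow> verts G - M \<noteq> {} \<and>
     (\<forall>S. edge_closed_outside G M S \<longrightarrow> verts G - M \<subseteq> S \<or> (verts G - M) \<inter> S = {})"
proof -
  have V: "verts (delete_verts G M) = verts G - M" by (simp add: delete_verts_def)
  have restrict: "edge_closed_outside G M ((verts G - M) \<inter> S) \<longleftrightarrow> edge_closed_outside G M S" for S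
    unfolding edge_closed_outside_def using edgeD(2,3) by (metis DiffI Int_iff)
  have "connected_graph (delete_verts G M) \<longleftrightarrow> verts G - M \<noteq> {} \<and>
     (\<forall>S. edge_closed_outside G M ((verts G - M) \<inter> S) \<longrightarrow>
        (verts G - M) \<inter> S = {} \<or> (verts G - M) \<inter> S = verts G - M)"
    unfolding simple_graph.connected_graph_iff_edge_cut[OF simple_graph_delete_verts]
      edge_cut_delete_verts_eq_empty_iff V
    by (metis inf.absorb2 inf_le1)
  then show ?thesis unfolding restrict by blast
qed

lemma vertex_connectedD:
  assumes "vertex_connected k G" "card (verts G \<inter> M) < k" "edge_closed_outside G M S"
  shows "verts G - M \<subseteq> S \<or> (verts G - M) \<inter> S = {}"
proof -
  have "connected_graph (delete_verts G (verts G \<inter> M))"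
    using assms(1,2) by (simp add: vertex_connected_def)
  moreover have "edge_closed_outside G (verts G \<inter> M) S"
    using assms(3) edgeD(2,3) unfolding edge_closed_outside_def by blast
  ultimately show ?thesis unfolding connected_delete_verts_iff by (simp add: Diff_Int)
qed

end

locale simple_matching_join =
  left: simple_graph G\<^sub>1 + right: simple_graph G\<^sub>2
  for f :: "'a \<Rightarrow> 'a" and G\<^sub>1 G\<^sub>2 :: "'a graph" +
  assumes disjoint: "verts G\<^sub>1 \<inter> verts G\<^sub>2 = {}"
    and bij: "bij_betw f (verts G\<^sub>1) (verts G\<^sub>2)"
begin

abbreviation J :: "'a graph" where
  "J \<equiv> matching_join f G\<^sub>1 G\<^sub>2"

lemma verts_join: "verts J = verts G\<^sub>1 \<union> verts G\<^sub>2"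
  by (simp add: matching_join_def)

lemma match_in [intro]: "x \<in> verts G\<^sub>1 \<Longrightarrow> f x \<in> verts G\<^sub>2"
  using bij by (rule bij_betwE[rule_format])

sublocale join: simple_graph J
proof
  show "finite (verts J)" using left.finite_verts right.finite_verts by (simp add: verts_join)
  fix e assume "e \<in> edges J"
  then consider "e \<in> edges G\<^sub>1" | "e \<in> edges G\<^sub>2" | x where "x \<in> verts G\<^sub>1" "e = {x, f x}"
    by (auto simp: matching_join_def)
  then have "e \<subseteq> verts J \<and> card e = 2"
  proof cases
    case 1
    then show ?thesis using left.edge_subset left.card_edge by (auto simp: verts_join)
  next
    case 2
    then show ?thesis using right.edge_subset right.card_edge by (auto simp: verts_join)
  next
    case 3
    then have "x \<noteq> f x" using disjoint match_in by (metis disjoint_iff)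
    then show ?thesis using 3 match_in by (simp add: verts_join)
  qed
  then show "e \<subseteq> verts J" "card e = 2" by simp_all
qed

lemma swap: "simple_matching_join (inv_into (verts G\<^sub>1) f) G\<^sub>2 G\<^sub>1"
  using disjoint bij_betw_inv_into[OF bij] by unfold_locales auto

lemma matching_join_swap: "matching_join (inv_into (verts G\<^sub>1) f) G\<^sub>2 G\<^sub>1 = J"
proof -
  have inj: "inj_on f (verts G\<^sub>1)" and im: "verts G\<^sub>2 = f ` verts G\<^sub>1"
    using bij by (simp_all add: bij_betw_def)
  have "{{y, inv_into (verts G\<^sub>1) f y} | y. y \<in> verts G\<^sub>2} = {{x, f x} | x. x \<in> verts G\<^sub>1}"
    unfolding im Setcompr_eq_image image_image using inj
    by (intro image_cong) (auto simp: insert_commute)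
  then show ?thesis by (simp add: matching_join_def Un_ac)
qed

lemma neighbours_left:
  assumes "x \<in> verts G\<^sub>1"
  shows "neighbours J x = insert (f x) (neighbours G\<^sub>1 x)"
proof -
  have "{x, y} \<notin> edges G\<^sub>2" for y using assms disjoint by (auto dest: right.edgeD)
  moreover have "x \<noteq> f z" if "z \<in> verts G\<^sub>1" for z using that assms disjoint by blast
  ultimately show ?thesis
    using assms by (auto simp: neighbours_def matching_join_def doubleton_eq_iff)
qed

lemma degree_left:
  assumes "x \<in> verts G\<^sub>1"
  shows "degree J x = Suc (degree G\<^sub>1 x)"
proof -
  have "f x \<notin> neighbours G\<^sub>1 x" using assms left.neighbours_subset disjoint by blast
  then show ?thesis
    using assms left.finite_neighbours
    by (simp add: join.degree_eq_card_neighbours left.degree_eq_card_neighbours neighbours_left)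
qed

lemma regular_graph_join:
  assumes "regular_graph d G\<^sub>1" "regular_graph d G\<^sub>2"
  shows "regular_graph (Suc d) J"
proof -
  interpret swap: simple_matching_join "inv_into (verts G\<^sub>1) f" G\<^sub>2 G\<^sub>1 by (rule swap)
  show ?thesis
    using assms degree_left swap.degree_left[unfolded matching_join_swap]
    by (auto simp: regular_graph_def verts_join)
qed

lemma neighbours_disjoint_left:
  assumes "triangle_free G\<^sub>1" "x \<in> verts G\<^sub>1" "y \<in> verts G\<^sub>1" "{x, y} \<in> edges J"
  shows "neighbours J x \<inter> neighbours J y = {}"
proof -
  have "y \<noteq> f x" using assms(2,3) disjoint match_in by (metis disjoint_iff)
  then have "{x, y} \<in> edges G\<^sub>1"
    using assms(4) neighbours_left[OF assms(2)] by (auto simp: neighbours_def)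
  then have "neighbours G\<^sub>1 x \<inter> neighbours G\<^sub>1 y = {}" "x \<noteq> y"
    using assms(1) left.edgeD(1)[of x y] by (simp_all add: triangle_free_def)
  moreover have "f x \<noteq> f y" using assms(2,3) \<open>x \<noteq> y\<close> bij by (auto simp: bij_betw_def inj_on_def)
  moreover have "neighbours G\<^sub>1 x \<inter> verts G\<^sub>2 = {}" "neighbours G\<^sub>1 y \<inter> verts G\<^sub>2 = {}"
    using left.neighbours_subset disjoint by blast+
  ultimately show ?thesis using assms(2,3) by (auto simp: neighbours_left)
qed

text \<open>Two of the three vertices of a triangle lie on the same side of the join.\<close>

lemma triangle_free_join:
  assumes "triangle_free G\<^sub>1" "triangle_free G\<^sub>2"
  shows "triangle_free J"
proof -
  interpret swap: simple_matching_join "inv_into (verts G\<^sub>1) f" G\<^sub>2 G\<^sub>1 by (rule swap)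
  have same_side: "z \<notin> neighbours J x \<inter> neighbours J y"
    if "{x, y} \<in> edges J" "x \<in> verts G\<^sub>1 \<longleftrightarrow> y \<in> verts G\<^sub>1" for x y z
    using that neighbours_disjoint_left[OF assms(1), of x y] join.edgeD(2,3)[OF that(1)]
      swap.neighbours_disjoint_left[OF assms(2), of x y, unfolded matching_join_swap]
    by (auto simp: verts_join)
  have False if "{x, y} \<in> edges J" "{x, z} \<in> edges J" "{y, z} \<in> edges J" for x y z
    using that same_side[of x y z] same_side[of x z y] same_side[of y z x]
    by (auto simp: neighbours_def insert_commute)
  then show ?thesis unfolding triangle_free_def neighbours_def by blast
qed

lemma unfaulty_match_exists:
  assumes "finite M" "card M < card (verts G\<^sub>1)"
  obtains x where "x \<in> verts G\<^sub>1 - M" "f x \<in> verts G\<^sub>2 - M"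
proof -
  have "\<exists>x \<in> verts G\<^sub>1. x \<notin> M \<and> f x \<notin> M"
  proof (rule ccontr)
    assume "\<not> ?thesis"
    then have "(\<lambda>x. if x \<in> M then x else f x) ` verts G\<^sub>1 \<subseteq> M" by auto
    moreover have "inj_on (\<lambda>x. if x \<in> M then x else f x) (verts G\<^sub>1)"
      using bij disjoint by (auto simp: bij_betw_def inj_on_def)
    ultimately have "card (verts G\<^sub>1) \<le> card M" using assms(1) by (intro card_inj_on_le)
    then show False using assms(2) by simp
  qed
  then show thesis using that by blast
qed

lemma edge_closed_outside_left:
  assumes "edge_closed_outside J M S"
  shows "edge_closed_outside G\<^sub>1 M S"
  using assms by (auto simp: edge_closed_outside_def matching_join_def)

lemma card_eq_sum_of_sides:
  assumes "M \<subseteq> verts J"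
  shows "card M = card (verts G\<^sub>1 \<inter> M) + card (verts G\<^sub>2 \<inter> M)"
proof -
  have "finite M" using assms join.finite_verts by (rule finite_subset)
  then have "card (verts G\<^sub>1 \<inter> M \<union> verts G\<^sub>2 \<inter> M) = card (verts G\<^sub>1 \<inter> M) + card (verts G\<^sub>2 \<inter> M)"
    using disjoint by (intro card_Un_disjoint) auto
  moreover have "verts G\<^sub>1 \<inter> M \<union> verts G\<^sub>2 \<inter> M = M" using assms by (auto simp: verts_join)
  ultimately show ?thesis by simp
qed

text \<open>The side with fewer faults stays connected. A vertex of the other side is linked to it by its
  own matching edge if the other side has all \<open>k\<close> faults, and otherwise through any matching edge
  without faults, since then the other side is connected, too.\<close>

lemma connected_delete_verts_join:
  assumes conn: "vertex_connected k G\<^sub>1" "vertex_connected k G\<^sub>2" and k: "1 \<le> k"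
    and M: "M \<subseteq> verts J" "card M \<le> k" "card (verts G\<^sub>1 \<inter> M) \<le> card (verts G\<^sub>2 \<inter> M)"
  shows "connected_graph (delete_verts J M)"
proof -
  interpret swap: simple_matching_join "inv_into (verts G\<^sub>1) f" G\<^sub>2 G\<^sub>1 by (rule swap)
  have finM: "finite M" using M(1) join.finite_verts finite_subset by blast
  note cM = card_eq_sum_of_sides[OF M(1)]
  have "card M < card (verts G\<^sub>1)" using M(2) conn(1) by (simp add: vertex_connected_def)
  then obtain a where a: "a \<in> verts G\<^sub>1 - M" "f a \<in> verts G\<^sub>2 - M"
    using finM unfaulty_match_exists by blast
  have "verts J - M \<subseteq> S \<or> (verts J - M) \<inter> S = {}" if S: "edge_closed_outside J M S" for S
  proof -
    have match: "x \<in> S \<longleftrightarrow> f x \<in> S" if "x \<in> verts G\<^sub>1 - M" "f x \<in> verts G\<^sub>2 - M" for x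
      using S that by (auto simp: edge_closed_outside_def matching_join_def)
    have left: "verts G\<^sub>1 - M \<subseteq> S \<or> (verts G\<^sub>1 - M) \<inter> S = {}"
      using cM M(2,3) k
      by (intro left.vertex_connectedD[OF conn(1)] edge_closed_outside_left S) linarith
    have "y \<in> S \<longleftrightarrow> a \<in> S" if y: "y \<in> verts G\<^sub>2 - M" for y
    proof (cases "card (verts G\<^sub>2 \<inter> M) < k")
      case True
      then have "verts G\<^sub>2 - M \<subseteq> S \<or> (verts G\<^sub>2 - M) \<inter> S = {}"
        using S swap.edge_closed_outside_left[unfolded matching_join_swap]
        by (intro right.vertex_connectedD[OF conn(2)])
      then show ?thesis using match a y by blast
    next
      case False
      then have "card (verts G\<^sub>1 \<inter> M) = 0" using cM M(2) by linarith
      then have "verts G\<^sub>1 \<inter> M = {}" using finM by simp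
      moreover obtain x where "x \<in> verts G\<^sub>1" "y = f x" using y bij by (auto simp: bij_betw_def)
      ultimately show ?thesis using match[of x] left a y by blast
    qed
    then show ?thesis using left a by (auto simp: verts_join)
  qed
  then show ?thesis using a(1) by (auto simp: join.connected_delete_verts_iff verts_join)
qed

lemma vertex_connected_join:
  assumes "vertex_connected k G\<^sub>1" "vertex_connected k G\<^sub>2" "1 \<le> k"
  shows "vertex_connected (Suc k) J"
  unfolding vertex_connected_def
proof (intro conjI allI impI)
  interpret swap: simple_matching_join "inv_into (verts G\<^sub>1) f" G\<^sub>2 G\<^sub>1 by (rule swap)
  show "Suc k < card (verts J)"
    using assms left.finite_verts right.finite_verts disjoint
    by (simp add: verts_join card_Un_disjoint vertex_connected_def)
  fix M assume "M \<subseteq> verts J" "card M < Suc k"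
  then show "connected_graph (delete_verts J M)"
    using connected_delete_verts_join[OF assms, of M]
      swap.connected_delete_verts_join[OF assms(2,1,3), of M, unfolded matching_join_swap]
    by linarith
qed

end

section \<open>Hypercube-like networks\<close>

lemma simple_graph_hypercube_like: "hypercube_like n G \<Longrightarrow> simple_graph G"
proof (induction rule: hypercube_like.induct)
  case (K2 u v)
  then show ?case by unfold_locales auto
next
  case (join n G\<^sub>1 G\<^sub>2 f)
  then interpret simple_matching_join f G\<^sub>1 G\<^sub>2
    by (simp add: simple_matching_join_def simple_matching_join_axioms_def)
  show ?case by (rule join.simple_graph_axioms)
qed

lemma simple_matching_join_hypercube_like:
  assumes "hypercube_like n G\<^sub>1" "hypercube_like n G\<^sub>2" "verts G\<^sub>1 \<inter> verts G\<^sub>2 = {}"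
    "bij_betw f (verts G\<^sub>1) (verts G\<^sub>2)"
  shows "simple_matching_join f G\<^sub>1 G\<^sub>2"
  using assms
  by (simp add: simple_matching_join_def simple_matching_join_axioms_def simple_graph_hypercube_like)

lemma hypercube_like_pos: "hypercube_like n G \<Longrightarrow> 1 \<le> n"
  by (induction rule: hypercube_like.induct) auto

lemma regular_graph_hypercube_like: "hypercube_like n G \<Longrightarrow> regular_graph n G"
proof (induction rule: hypercube_like.induct)
  case (K2 u v)
  have "{e \<in> {{u, v}}. x \<in> e} = {{u, v}}" if "x \<in> {u, v}" for x using that by auto
  then show ?case by (simp add: regular_graph_def degree_def)
next
  case (join n G\<^sub>1 G\<^sub>2 f)
  then interpret simple_matching_join f G\<^sub>1 G\<^sub>2 by (intro simple_matching_join_hypercube_like)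
  show ?case using join.IH by (rule regular_graph_join)
qed

lemma triangle_free_hypercube_like: "hypercube_like n G \<Longrightarrow> triangle_free G"
proof (induction rule: hypercube_like.induct)
  case (K2 u v)
  then show ?case by (auto simp: triangle_free_def neighbours_def doubleton_eq_iff)
next
  case (join n G\<^sub>1 G\<^sub>2 f)
  then interpret simple_matching_join f G\<^sub>1 G\<^sub>2 by (intro simple_matching_join_hypercube_like)
  show ?case using join.IH by (rule triangle_free_join)
qed

lemma vertex_connected_hypercube_like: "hypercube_like n G \<Longrightarrow> vertex_connected n G"
proof (induction rule: hypercube_like.induct)
  case (K2 u v)
  let ?K = "\<lparr>verts = {u, v}, edges = {{u, v}}\<rparr>"
  interpret simple_graph ?K by (rule simple_graph_hypercube_like[OF hypercube_like.K2[OF K2]])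
  have "connected_graph (delete_verts ?K {})"
    by (auto simp: connected_delete_verts_iff edge_closed_outside_def)
  moreover have "M = {}" if "M \<subseteq> {u, v}" "card M < 1" for M
    using that finite_subset[OF that(1)] by simp
  ultimately show ?case using K2 by (auto simp: vertex_connected_def)
next
  case (join n G\<^sub>1 G\<^sub>2 f)
  then interpret simple_matching_join f G\<^sub>1 G\<^sub>2 by (intro simple_matching_join_hypercube_like)
  show ?case using join.IH hypercube_like_pos[OF join.hyps(1)] by (rule vertex_connected_join)
qed

section \<open>Edge cuts of line graphs\<close>

definition mixed_verts :: "'a graph \<Rightarrow> 'a set set \<Rightarrow> 'a set" where
  "mixed_verts G S = {x \<in> verts G. incident S x \<noteq> {} \<and> incident (edges G - S) x \<noteq> {}}"

lemma verts_line_graph [simp]: "verts (line_graph G) = edges G"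
  by (simp add: line_graph_def)

lemma line_graph_edge_iff:
  "{e, e'} \<in> edges (line_graph G) \<longleftrightarrow>
     e \<in> edges G \<and> e' \<in> edges G \<and> e \<noteq> e' \<and> e \<inter> e' \<noteq> {}"
  by (auto simp: line_graph_def doubleton_eq_iff)

lemma le_5_and_less_if_mult_less:
  fixes m n :: nat
  assumes "4 \<le> n" "m * (n - 1) < 6 * n - 12"
  shows "m \<le> 5" "m < n"
proof -
  have not_le: "\<not> k \<le> m" if "6 * n - 12 \<le> k * (n - 1)" for k
  proof
    assume "k \<le> m"
    then have "k * (n - 1) \<le> m * (n - 1)" by (rule mult_right_mono) simp
    then show False using assms(2) that by linarith
  qed
  have "6 * n - 12 \<le> 6 * (n - 1)" by linarith
  then show "m \<le> 5" using not_le[of 6] by linarith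
  then show "m < n" using not_le[of n] assms(1) by (cases "n = 4 \<or> n = 5") auto
qed

context simple_graph
begin

lemma simple_graph_line_graph: "simple_graph (line_graph G)"
proof
  fix z assume "z \<in> edges (line_graph G)"
  then obtain e e' where "z = {e, e'}" "e \<in> edges G" "e' \<in> edges G" "e \<noteq> e'"
    by (auto simp: line_graph_def)
  then show "z \<subseteq> verts (line_graph G)" "card z = 2" by simp_all
qed (simp add: finite_edges)

lemma finite_incident: "S \<subseteq> edges G \<Longrightarrow> finite (incident S x)"
  using finite_edges by (rule finite_subset[rotated]) (auto simp: incident_def)

lemma card_incident_complement:
  assumes "S \<subseteq> edges G"
  shows "card (incident S x) + card (incident (edges G - S) x) = degree G x"
proof -
  have "card (incident S x \<union> incident (edges G - S) x)
      = card (incident S x) + card (incident (edges G - S) x)"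
    using assms by (intro card_Un_disjoint finite_incident) (auto simp: incident_def)
  moreover have "incident S x \<union> incident (edges G - S) x = {e \<in> edges G. x \<in> e}"
    using assms by (auto simp: incident_def)
  ultimately show ?thesis by (simp add: degree_def)
qed

lemma card_neighbours_line_graph_outside:
  assumes S: "S \<subseteq> edges G" and e: "e \<in> S"
  shows "card (neighbours (line_graph G) e - S) = (\<Sum>x\<in>e. card (incident (edges G - S) x))"
proof -
  have "neighbours (line_graph G) e - S = (\<Union>x\<in>e. incident (edges G - S) x)"
    using assms by (auto simp: neighbours_def line_graph_edge_iff incident_def)
  moreover have "incident (edges G - S) x \<inter> incident (edges G - S) y = {}"
    if "x \<in> e" "y \<in> e" "x \<noteq> y" for x y
  proof -
    have "d = e" if "d \<in> edges G" "x \<in> d" "y \<in> d" for d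
      using edge_eq_doubleton[OF that \<open>x \<noteq> y\<close>] edge_eq_doubleton[of e x y] assms
        \<open>x \<in> e\<close> \<open>y \<in> e\<close> \<open>x \<noteq> y\<close> by auto
    then show ?thesis using e by (auto simp: incident_def)
  qed
  moreover have "finite e" using S e finite_edge by blast
  ultimately show ?thesis using finite_incident by (simp add: card_UN_disjoint)
qed

lemma card_edge_cut_line_graph:
  assumes "S \<subseteq> edges G"
  shows "card (edge_cut (line_graph G) S) = (\<Sum>e\<in>S. \<Sum>x\<in>e. card (incident (edges G - S) x))"
proof -
  have "finite S" using assms finite_edges finite_subset by blast
  then show ?thesis
    using simple_graph.card_edge_cut[OF simple_graph_line_graph] assms
    by (simp add: card_neighbours_line_graph_outside)
qed

lemma card_edge_cut_line_graph_eq_sum_verts: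
  assumes "S \<subseteq> edges G"
  shows "card (edge_cut (line_graph G) S) =
    (\<Sum>x\<in>verts G. card (incident S x) * card (incident (edges G - S) x))"
proof -
  have "finite S" using assms finite_edges finite_subset by blast
  have "(\<Sum>e\<in>S. \<Sum>x\<in>e. card (incident (edges G - S) x))
      = (\<Sum>e\<in>S. \<Sum>x\<in>{x \<in> verts G. x \<in> e}. card (incident (edges G - S) x))"
    using assms edge_subset by (intro sum.cong) auto
  also have "\<dots> = (\<Sum>x\<in>verts G. \<Sum>e\<in>{e \<in> S. x \<in> e}. card (incident (edges G - S) x))"
    using \<open>finite S\<close> finite_verts by (rule sum.swap_restrict)
  finally show ?thesis by (simp add: card_edge_cut_line_graph[OF assms] incident_def)
qed

lemma degree_line_graph:
  assumes "e \<in> edges G"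
  shows "degree (line_graph G) e = (\<Sum>x\<in>e. degree G x - 1)"
proof -
  have "card (incident (edges G - {e}) x) = degree G x - 1" if "x \<in> e" for x
  proof -
    have "incident {e} x = {e}" using that by (auto simp: incident_def)
    then show ?thesis using card_incident_complement[of "{e}" x] assms by simp
  qed
  then show ?thesis
    using assms simple_graph.degree_eq_card_edge_cut[OF simple_graph_line_graph, of e]
    by (simp add: card_edge_cut_line_graph)
qed

lemma regular_graph_line_graph:
  assumes "regular_graph d G"
  shows "regular_graph (2 * d - 2) (line_graph G)"
  unfolding regular_graph_def
proof
  fix e assume e: "e \<in> verts (line_graph G)"
  then have "(\<Sum>x\<in>e. degree G x - 1) = (\<Sum>x\<in>e. d - 1)"
    using assms edge_subset[of e] by (intro sum.cong) (auto simp: regular_graph_def)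
  then show "degree (line_graph G) e = 2 * d - 2"
    using e card_edge by (simp add: degree_line_graph diff_mult_distrib2)
qed

lemma card_incident_edge_le_Suc_card:
  assumes S: "S \<subseteq> edges G" and xy: "{x, y} \<in> S"
  shows "card (incident S x) + card (incident S y) \<le> Suc (card S)"
proof -
  have "x \<noteq> y" using assms edgeD(1) by blast
  then have "incident S x \<inter> incident S y \<subseteq> {{x, y}}"
    using S edge_eq_doubleton by (auto simp: incident_def)
  then have "card (incident S x \<inter> incident S y) \<le> card {{x, y}}" by (intro card_mono) auto
  moreover have "card (incident S x \<union> incident S y) \<le> card S"
    using S finite_edges finite_subset by (intro card_mono) (auto simp: incident_def)
  moreover have "card (incident S x) + card (incident S y)
      = card (incident S x \<union> incident S y) + card (incident S x \<inter> incident S y)"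
    using S finite_incident by (intro card_Un_Int)
  ultimately show ?thesis by simp
qed

lemma card_incident_edge_le_card_verts:
  assumes "triangle_free G" and S: "S \<subseteq> edges G" "{x, y} \<in> S" and M: "S \<subseteq> Pow M" "finite M"
  shows "card (incident S x) + card (incident S y) \<le> card M"
proof -
  let ?N = "\<lambda>x. {z. {x, z} \<in> S}"
  have sub: "?N z \<subseteq> M" for z using M(1) by blast
  have "neighbours G x \<inter> neighbours G y = {}" using assms(1) S by (auto simp: triangle_free_def)
  then have "?N x \<inter> ?N y = {}" using S by (auto simp: neighbours_def)
  then have "card (?N x) + card (?N y) = card (?N x \<union> ?N y)"
    using sub M(2) finite_subset by (intro card_Un_disjoint[symmetric]) blast+
  also have "\<dots> \<le> card M" using sub M(2) by (intro card_mono) auto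
  finally show ?thesis by (simp add: card_incident[OF S(1)])
qed

lemma card_edge_cut_line_graph_ge_mult:
  assumes d: "regular_graph d G" and S: "S \<subseteq> edges G"
    and m: "\<And>x y. {x, y} \<in> S \<Longrightarrow> card (incident S x) + card (incident S y) \<le> m"
  shows "card S * (2 * d - m) \<le> card (edge_cut (line_graph G) S)"
proof -
  have "2 * d - m \<le> (\<Sum>x\<in>e. card (incident (edges G - S) x))" if e: "e \<in> S" for e
  proof -
    obtain x y where xy: "x \<noteq> y" "e = {x, y}" "x \<in> verts G" "y \<in> verts G"
      using e S edgeE by blast
    have "card (incident S z) + card (incident (edges G - S) z) = d" if "z \<in> {x, y}" for z
      using card_incident_complement[OF S] d that xy by (auto simp: regular_graph_def)
    from this[of x] this[of y] show ?thesis using m[of x y] e xy by simp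
  qed
  then show ?thesis
    unfolding card_edge_cut_line_graph[OF S] using sum_bounded_below[of S "2 * d - m"] by simp
qed

lemma card_edge_cut_line_graph_ge_if_few_verts:
  assumes d: "regular_graph d G" "4 \<le> d" and "triangle_free G"
    and S: "S \<subseteq> edges G" "3 \<le> card S" and M: "S \<subseteq> Pow M" "finite M" "card M \<le> 5"
  shows "6 * d - 12 \<le> card (edge_cut (line_graph G) S)"
proof (cases "card S = 3")
  case True
  have "card S * (2 * d - Suc (card S)) \<le> card (edge_cut (line_graph G) S)"
    using card_incident_edge_le_Suc_card[OF S(1)]
    by (rule card_edge_cut_line_graph_ge_mult[OF d(1) S(1)])
  then show ?thesis using True by simp
next
  case False
  then have "4 * (2 * d - 5) \<le> card S * (2 * d - 5)" using S(2) by (intro mult_right_mono) auto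
  also have "\<dots> \<le> card (edge_cut (line_graph G) S)"
    using card_incident_edge_le_card_verts[OF assms(3) S(1) _ M(1,2)] M(3)
    by (intro card_edge_cut_line_graph_ge_mult[OF d(1) S(1)]) (meson order_trans)
  finally show ?thesis using d(2) by linarith
qed

lemma card_edge_cut_line_graph_ge_mixed_verts:
  assumes d: "regular_graph d G" and S: "S \<subseteq> edges G"
  shows "card (mixed_verts G S) * (d - 1) \<le> card (edge_cut (line_graph G) S)"
proof -
  let ?st = "\<lambda>x. card (incident S x) * card (incident (edges G - S) x)"
  have "d - 1 \<le> ?st x" if x: "x \<in> mixed_verts G S" for x
  proof -
    have "card (incident S x) \<noteq> 0" "card (incident (edges G - S) x) \<noteq> 0"
      using x S finite_incident by (auto simp: mixed_verts_def)
    moreover have "card (incident S x) + card (incident (edges G - S) x) = d"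
      using x d card_incident_complement[OF S] by (simp add: mixed_verts_def regular_graph_def)
    ultimately show ?thesis by (auto simp: gr0_conv_Suc)
  qed
  then have "card (mixed_verts G S) * (d - 1) \<le> sum ?st (mixed_verts G S)"
    using sum_bounded_below[of "mixed_verts G S" "d - 1" ?st] by simp
  also have "\<dots> \<le> sum ?st (verts G)"
    using finite_verts by (intro sum_mono2) (auto simp: mixed_verts_def)
  finally show ?thesis by (simp add: card_edge_cut_line_graph_eq_sum_verts[OF S])
qed

lemma edge_set_within_mixed_verts:
  assumes k: "vertex_connected k G" "card (mixed_verts G S) < k" and S: "S \<subseteq> edges G"
  shows "S \<subseteq> Pow (mixed_verts G S) \<or> edges G - S \<subseteq> Pow (mixed_verts G S)"
proof -
  let ?M = "mixed_verts G S" and ?X = "{x. incident S x \<noteq> {}}"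
  have pure: "e \<in> S \<longleftrightarrow> x \<in> ?X" if "e \<in> edges G" "x \<in> e" "x \<notin> ?M" for e x
    using that edge_subset by (auto simp: mixed_verts_def incident_def)
  have "edge_closed_outside G ?M ?X"
    unfolding edge_closed_outside_def using pure by blast
  moreover have "card (verts G \<inter> ?M) < k"
    using k(2) by (simp add: mixed_verts_def Int_absorb1)
  ultimately have "verts G - ?M \<subseteq> ?X \<or> (verts G - ?M) \<inter> ?X = {}"
    by (intro vertex_connectedD[OF k(1)])
  then show ?thesis
    using pure S edge_subset by blast
qed

lemma card_edge_cut_line_graph_ge:
  assumes n: "4 \<le> n" and G: "regular_graph n G" "triangle_free G" "vertex_connected n G"
    and S: "S \<subseteq> edges G" "3 \<le> card S" "3 \<le> card (edges G - S)"
  shows "6 * n - 12 \<le> card (edge_cut (line_graph G) S)"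
proof (cases "6 * n - 12 \<le> card (mixed_verts G S) * (n - 1)")
  case True
  then show ?thesis
    using card_edge_cut_line_graph_ge_mixed_verts[OF G(1) S(1)] by (rule order_trans)
next
  case False
  then have few: "card (mixed_verts G S) \<le> 5" "card (mixed_verts G S) < n"
    using le_5_and_less_if_mult_less[OF n] by (simp_all add: not_le)
  have fin: "finite (mixed_verts G S)" using finite_verts by (simp add: mixed_verts_def)
  from edge_set_within_mixed_verts[OF G(3) few(2) S(1)] show ?thesis
  proof
    assume "S \<subseteq> Pow (mixed_verts G S)"
    then show ?thesis
      using fin few(1) by (rule card_edge_cut_line_graph_ge_if_few_verts[OF G(1) n G(2) S(1,2)])
  next
    assume "edges G - S \<subseteq> Pow (mixed_verts G S)"
    then have "6 * n - 12 \<le> card (edge_cut (line_graph G) (edges G - S))"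
      using fin few(1)
      by (rule card_edge_cut_line_graph_ge_if_few_verts[OF G(1) n G(2) Diff_subset S(3)])
    then show ?thesis
      using simple_graph.edge_cut_complement[OF simple_graph_line_graph, of S] S(1) by simp
  qed
qed

end

section \<open>Fault-tolerant strong Menger edge connectivity of line graphs\<close>

context simple_graph
begin

lemma degree_delete_edges_le: "degree (delete_edges G F) x \<le> degree G x"
  unfolding degree_def using finite_edges by (intro card_mono) auto

lemma edges_nonempty_if_regular:
  assumes "regular_graph d G" "0 < d" "verts G \<noteq> {}"
  shows "edges G \<noteq> {}"
proof -
  obtain x where "x \<in> verts G" using assms(3) by blast
  then have "0 < degree G x" using assms(1,2) by (simp add: regular_graph_def)
  then show ?thesis by (auto simp: degree_def)
qed

lemma strongly_Menger_line_graph_delete_edges: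
  assumes n: "4 \<le> n" and G: "regular_graph n G" "triangle_free G" "vertex_connected n G"
    and "edges G \<noteq> {}" and F: "finite F" "card F \<le> 4 * n - 10"
    and deg: "2 \<le> min_degree (delete_edges (line_graph G) F)"
  shows "strongly_Menger_edge_connected (delete_edges (line_graph G) F)"
proof -
  let ?H = "delete_edges (line_graph G) F"
  interpret L: simple_graph "line_graph G" by (rule simple_graph_line_graph)
  interpret H: simple_graph ?H by (rule simple_graph_delete_edges[OF simple_graph_line_graph])
  show ?thesis
  proof (rule H.strongly_Menger_edge_connected_if_large_cuts)
    show nonempty: "verts ?H \<noteq> {}" using \<open>edges G \<noteq> {}\<close> by simp
    show "2 \<le> degree ?H e" if "e \<in> verts ?H" for e
      using deg that unfolding H.le_min_degree_iff[OF nonempty] by blast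
    fix S e assume S: "S \<subseteq> verts ?H" "2 < card S" "2 < card (verts ?H - S)" and e: "e \<in> verts ?H"
    have "degree ?H e \<le> 2 * n - 2"
      using L.degree_delete_edges_le[of F e] regular_graph_line_graph[OF G(1)] e
      by (simp add: regular_graph_def)
    also have "2 * n - 2 \<le> card (edge_cut (line_graph G) S) - card F"
      using card_edge_cut_line_graph_ge[OF n G, of S] S F(2) n by simp
    also have "\<dots> \<le> card (edge_cut ?H S)"
      unfolding edge_cut_delete_edges using F(1) by (rule diff_card_le_card_Diff)
    finally show "degree ?H e \<le> card (edge_cut ?H S)" .
  qed simp
qed

theorem conditional_eft_strongly_Menger_line_graph:
  assumes n: "4 \<le> n" and G: "regular_graph n G" "triangle_free G" "vertex_connected n G"
  shows "conditional_eft_strongly_Menger (4 * n - 10) (line_graph G)"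
proof -
  interpret L: simple_graph "line_graph G" by (rule simple_graph_line_graph)
  have "verts G \<noteq> {}" using G(3) by (auto simp: vertex_connected_def)
  then have nonempty: "edges G \<noteq> {}" using n by (intro edges_nonempty_if_regular[OF G(1)]) auto
  have faulty: "strongly_Menger_edge_connected (delete_edges (line_graph G) F)"
    if "finite F" "card F \<le> 4 * n - 10" "2 \<le> min_degree (delete_edges (line_graph G) F)" for F
    using assms nonempty that by (rule strongly_Menger_line_graph_delete_edges)
  have "2 \<le> min_degree (line_graph G)"
    using regular_graph_line_graph[OF G(1)] n nonempty
    by (auto simp: L.le_min_degree_iff regular_graph_def)
  then have "connected_graph (line_graph G)"
    using faulty[of "{}"] by (simp add: strongly_Menger_edge_connected_def)
  then show ?thesis using faulty by (simp add: conditional_eft_strongly_Menger_def)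
qed

end

section \<open>Sharpness\<close>

context simple_graph
begin

lemma card_edge_cut_clique:
  assumes d: "regular_graph d G" and S: "clique G S" "finite S"
  shows "card (edge_cut G S) = card S * (d - (card S - 1))"
proof -
  have "card (neighbours G x - S) = d - (card S - 1)" if "x \<in> S" for x
    using card_neighbours_outside_clique[OF S that] d S(1) that
    by (auto simp: clique_def regular_graph_def)
  then show ?thesis using S(2) by (simp add: card_edge_cut)
qed

lemma card_edge_cut_clique_minus_incident:
  assumes d: "regular_graph d G" and S: "clique G S" "finite S" and u: "u \<in> S"
  shows "(card S - 1) * (d - (card S - 1)) \<le> card (edge_cut G S - incident (edges G) u)"
proof -
  let ?I = "(\<lambda>y. {u, y}) ` (neighbours G u - S)"
  have fin: "finite (edge_cut G S \<inter> incident (edges G) u)" using finite_edge_cut by simp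
  have "edge_cut G S \<inter> incident (edges G) u \<subseteq> ?I"
  proof
    fix e assume e: "e \<in> edge_cut G S \<inter> incident (edges G) u"
    then obtain y where "e = {u, y}" using edge_other_end[of e u] by (auto simp: incident_def)
    then show "e \<in> ?I" using e u by (auto simp: edge_cut_def neighbours_def)
  qed
  then have "card (edge_cut G S \<inter> incident (edges G) u) \<le> card ?I"
    using finite_neighbours by (intro card_mono) auto
  also have "\<dots> \<le> card (neighbours G u - S)" using finite_neighbours by (intro card_image_le) auto
  also have "\<dots> = d - (card S - 1)"
    using d S(1) u card_neighbours_outside_clique[OF S u]
    by (auto simp: clique_def regular_graph_def)
  finally have "card (edge_cut G S) - (d - (card S - 1)) \<le> card (edge_cut G S - incident (edges G) u)"
    using card_Diff_subset_Int[OF fin] by linarith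
  then show ?thesis by (simp add: card_edge_cut_clique[OF d S] diff_mult_distrib)
qed

lemma degree_delete_edges_clique_cut_ge:
  assumes d: "regular_graph d G" and S: "clique G S" "finite S" "u \<in> S"
    and F: "F \<subseteq> edge_cut G S - incident (edges G) u" and x: "x \<in> verts G"
  shows "min (card S - 1) (d - (card S - 1)) \<le> degree (delete_edges G F) x"
proof -
  interpret H: simple_graph "delete_edges G F"
    by (rule simple_graph_delete_edges[OF simple_graph_axioms])
  let ?T = "if x \<in> S then S - {x} else neighbours G x - (S - {u})"
  have "?T \<subseteq> neighbours (delete_edges G F) x"
    using F S(1) by (auto simp: clique_def neighbours_def edge_cut_def incident_def)
  then have "card ?T \<le> degree (delete_edges G F) x"
    unfolding H.degree_eq_card_neighbours by (rule card_mono[OF H.finite_neighbours])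
  moreover have "d - (card S - 1) \<le> card (neighbours G x - (S - {u}))"
    using diff_card_le_card_Diff[of "S - {u}" "neighbours G x"] d x S(2,3)
    by (simp add: regular_graph_def degree_eq_card_neighbours)
  ultimately show ?thesis using S(2) by (simp split: if_splits)
qed

lemma not_strongly_Menger_delete_edges_clique_cut:
  assumes regular: "regular_graph d G"
    and clique: "clique G S" "finite S" "3 \<le> card S" "card S < d"
    and u: "u \<in> S" and v: "v \<in> verts G - S" "neighbours G v \<inter> S \<subseteq> {u}"
    and F: "F \<subseteq> edge_cut G S - incident (edges G) u"
    and card_F: "card F = (card S - 1) * (d - (card S - 1)) - 1"
  shows "\<not> strongly_Menger_edge_connected (delete_edges G F)"
proof
  let ?H = "delete_edges G F"
  interpret H: simple_graph ?H by (rule simple_graph_delete_edges[OF simple_graph_axioms])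
  assume "strongly_Menger_edge_connected ?H"
  then have "min (degree ?H u) (degree ?H v) \<le> card (edge_cut ?H S)"
    using u v(1) clique(1) by (intro H.strongly_Menger_edge_connectedD) (auto simp: clique_def)
  moreover have "degree ?H x = d" if "x \<in> {u, v}" for x
  proof -
    have "neighbours ?H x = neighbours G x"
      using that F v by (auto simp: neighbours_def edge_cut_def incident_def)
    then show ?thesis
      using that regular u v(1) clique(1)
      by (auto simp: H.degree_eq_card_neighbours degree_eq_card_neighbours[symmetric]
          regular_graph_def clique_def)
  qed
  moreover have "card (edge_cut ?H S) = Suc (d - (card S - 1))"
  proof -
    let ?m = "d - (card S - 1)"
    have "card (edge_cut ?H S) = card (edge_cut G S) - card F"
      unfolding edge_cut_delete_edges using F finite_subset[OF F] finite_edge_cut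
      by (intro card_Diff_subset) auto
    also have "card (edge_cut G S) = ?m + (card S - 1) * ?m"
      unfolding card_edge_cut_clique[OF regular clique(1,2)] using clique(3) by (simp add: mult_eq_if)
    finally have "card (edge_cut ?H S) = ?m + (card S - 1) * ?m - card F" .
    moreover have "0 < (card S - 1) * ?m" using clique(3,4) by simp
    ultimately show ?thesis using card_F by linarith
  qed
  ultimately have "d \<le> Suc (d - (card S - 1))" by simp
  then show False using clique(3,4) by linarith
qed

text \<open>All but one of the edges that leave the clique from a vertex other than \<open>u\<close> are deleted.
  Then \<open>u\<close> and \<open>v\<close> keep their full degree \<open>d\<close>, while only \<open>d - |S| + 2 < d\<close> edges leave the clique.\<close>

lemma not_conditional_eft_strongly_Menger_if_clique:
  assumes regular: "regular_graph d G"
    and clique: "clique G S" "3 \<le> card S" "card S < d"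
    and u: "u \<in> S" and v: "v \<in> verts G - S" "neighbours G v \<inter> S \<subseteq> {u}"
    and k: "(card S - 1) * (d - (card S - 1)) \<le> Suc k"
  shows "\<not> conditional_eft_strongly_Menger k G"
proof
  assume eft: "conditional_eft_strongly_Menger k G"
  have fin: "finite S" using clique(2) card.infinite by fastforce
  let ?c = "(card S - 1) * (d - (card S - 1))"
  have "?c - 1 \<le> card (edge_cut G S - incident (edges G) u)"
    using card_edge_cut_clique_minus_incident[OF regular clique(1) fin u] by simp
  then obtain F where F: "F \<subseteq> edge_cut G S - incident (edges G) u" "card F = ?c - 1"
    by (rule obtain_subset_with_card_n)
  interpret H: simple_graph "delete_edges G F"
    by (rule simple_graph_delete_edges[OF simple_graph_axioms])
  have "2 \<le> min_degree (delete_edges G F)"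
    using degree_delete_edges_clique_cut_ge[OF regular clique(1) fin u F(1)] clique(2,3) v(1)
      H.le_min_degree_iff by fastforce
  moreover have "F \<subseteq> edges G" using F(1) by (auto simp: edge_cut_def)
  moreover from this have "finite F" using finite_edges finite_subset by blast
  moreover have "card F \<le> k" using F(2) k by linarith
  ultimately have "strongly_Menger_edge_connected (delete_edges G F)"
    using eft unfolding conditional_eft_strongly_Menger_def by blast
  then show False using not_strongly_Menger_delete_edges_clique_cut
      [OF regular clique(1) fin clique(2,3) u v F] by simp
qed

lemma claw_with_pendant_edge:
  assumes d: "regular_graph d G" "4 \<le> d" and "verts G \<noteq> {}"
  obtains a b c x y where "{{a, b}, {a, c}, {a, x}, {x, y}} \<subseteq> edges G"
    "distinct [a, b, c, x]" "y \<notin> {a, b, c, x}"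
proof -
  have neighbour: "\<exists>z \<in> neighbours G w. z \<notin> set A" if "w \<in> verts G" "length A \<le> 3" for w A
  proof (rule ccontr)
    assume "\<not> ?thesis"
    then have "card (neighbours G w) \<le> card (set A)" by (intro card_mono) auto
    also have "\<dots> \<le> 3" using card_length that(2) by (rule order_trans)
    finally show False
      using that(1) d by (simp add: regular_graph_def degree_eq_card_neighbours[symmetric])
  qed
  obtain a where a: "a \<in> verts G" using assms(3) by blast
  obtain b where b: "b \<in> neighbours G a" using neighbour[OF a, of "[]"] by auto
  obtain c where c: "c \<in> neighbours G a" "c \<noteq> b" using neighbour[OF a, of "[b]"] by auto
  obtain x where x: "x \<in> neighbours G a" "x \<notin> {b, c}"
    using neighbour[OF a, of "[b, c]"] by auto
  have "x \<in> verts G" using x(1) neighbours_subset by blast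
  then obtain y where y: "y \<in> neighbours G x" "y \<notin> {a, b, c}"
    using neighbour[of x "[a, b, c]"] by auto
  have "z \<noteq> w" if "z \<in> neighbours G w" for w z using that neighbours_subset by blast
  then show thesis
    using that[of a b c x y] b c x y by (auto simp: neighbours_def)
qed

theorem not_conditional_eft_strongly_Menger_line_graph:
  assumes n: "4 \<le> n" and G: "regular_graph n G" "verts G \<noteq> {}" and k: "4 * n - 10 < k"
  shows "\<not> conditional_eft_strongly_Menger k (line_graph G)"
proof -
  interpret L: simple_graph "line_graph G" by (rule simple_graph_line_graph)
  obtain a b c x y where E: "{{a, b}, {a, c}, {a, x}, {x, y}} \<subseteq> edges G"
    and distinct: "distinct [a, b, c, x]" "y \<notin> {a, b, c, x}"
    by (rule claw_with_pendant_edge[OF G(1) n G(2)])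
  let ?S = "{{a, b}, {a, c}, {a, x}}"
  have card_S: "card ?S = 3" using distinct by (auto simp: doubleton_eq_iff)
  show ?thesis
  proof (rule L.not_conditional_eft_strongly_Menger_if_clique)
    show "regular_graph (2 * n - 2) (line_graph G)" by (rule regular_graph_line_graph[OF G(1)])
    show "clique (line_graph G) ?S" using E by (auto simp: clique_def line_graph_edge_iff)
    show "3 \<le> card ?S" "card ?S < 2 * n - 2" using card_S n by simp_all
    show "{a, x} \<in> ?S" by simp
    show "{x, y} \<in> verts (line_graph G) - ?S" using E distinct by (auto simp: doubleton_eq_iff)
    show "neighbours (line_graph G) {x, y} \<inter> ?S \<subseteq> {{a, x}}"
      using distinct by (auto simp: neighbours_def line_graph_edge_iff)
    show "(card ?S - 1) * (2 * n - 2 - (card ?S - 1)) \<le> Suc k" using card_S k n by simp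
  qed
qed

end

theorem theorem4p2:
  fixes n :: nat and Q :: "'a graph"
  assumes "n \<ge> 4" and "hypercube_like n Q"
  shows "conditional_eft_strongly_Menger (4 * n - 10) (line_graph Q) \<and>
         (\<forall>k > 4 * n - 10. \<not> conditional_eft_strongly_Menger k (line_graph Q))"
proof (intro conjI allI impI)
  interpret simple_graph Q by (rule simple_graph_hypercube_like[OF assms(2)])
  have regular: "regular_graph n Q" by (rule regular_graph_hypercube_like[OF assms(2)])
  have connected: "vertex_connected n Q" by (rule vertex_connected_hypercube_like[OF assms(2)])
  then have "verts Q \<noteq> {}" by (auto simp: vertex_connected_def)
  show "conditional_eft_strongly_Menger (4 * n - 10) (line_graph Q)"
    using assms(1) regular triangle_free_hypercube_like[OF assms(2)] connected
    by (rule conditional_eft_strongly_Menger_line_graph)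
  show "\<not> conditional_eft_strongly_Menger k (line_graph Q)" if "4 * n - 10 < k" for k
    using assms(1) regular \<open>verts Q \<noteq> {}\<close> that
    by (rule not_conditional_eft_strongly_Menger_line_graph)
qed

end
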